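(* Let $d\in\mathbb{Z}_+$ and let $\mathcal{M}$ be an infinite matrix of real numbers. Then $\mathcal{M}$ is a Hankel-Sobolev matrix of index $d$ if and only if $\mathcal{M}$ is a symmetric matrix and $$\Phi(\mathcal{M},2d+1)=\mathcal{O}\quad\text{and}\quad \Phi(\mathcal{M},2d)\neq\mathcal{O}.$$ Moreover, in this case, for $k=0,1,\dots,d$ the Hankel matrix $\mathcal{H}_{d-k}$ in the decomposition $\mathcal{M}=\sum_{k=0}^{\infty}\mathcal{U}^{-k}\mathcal{D}_k\mathcal{H}_k\mathcal{D}_k\mathcal{U}^{k}$ is given by $$\mathcal{H}_{d-k}=\frac{(-1)^{d-k}}{(2d-2k)!}\,\Phi(\mathcal{M}_{d-k},2d-2k),$$ where $\mathcal{M}_d=\mathcal{M}$ and $\mathcal{M}_{d-k}=\mathcal{M}_{d-k+1}-\mathcal{U}^{-d-1+k}\mathcal{D}_{d+1-k}\mathcal{H}_{d+1-k}\mathcal{D}_{d+1-k}\mathcal{U}^{d+1-k}$ for $k=1,2,\dots,d$.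
   Context: $\mathbb{Z}_+=\{0,1,2,\dots\}$. Infinite matrices have real entries indexed by $(i,j)\in\mathbb{Z}_+\times\mathbb{Z}_+$; $\mathcal{O}$ is the infinite null matrix and $\mathcal{I}$ the infinite unit matrix. All products of infinite matrices considered are such that each entry is a sum with finitely many nonzero terms. $\mathcal{U}$ is the infinite matrix with $(i,j)$ entry $\delta_{i+1,j}$ (upper shift); $\mathcal{U}^{-1}:=\mathcal{U}^{\mathsf T}$ is its right-hand inverse ($\mathcal{U}\,\mathcal{U}^{\mathsf T}=\mathcal{I}$), and $\mathcal{U}^{-m}:=(\mathcal{U}^{-1})^m$ for $m\in\mathbb{Z}_+$. A matrix $\mathcal{H}=(h_{i,j})_{i,j\ge 0}$ is a Hankel matrix if $h_{i,j+1}=h_{i+1,j}$ for all $i,j\in\mathbb{Z}_+$. $\mathcal{D}_0=\mathcal{I}$ and, for $k>0$, $\mathcal{D}_k$ is the infinite diagonal matrix whose $i$th diagonal entry is $\frac{(k+i)!}{i!}$, $i\ge 0$. $\mathcal{M}$ is a Hankel-Sobolev matrix if there is a sequence of Hankel matrices $\{\mathcal{H}_k\}_{k=0}^\infty$ such that $\mathcal{M}=\sum_{k=0}^{\infty}\mathcal{U}^{-k}\mathcal{D}_k\mathcal{H}_k\mathcal{D}_k\mathcal{U}^{k}$ (each entry is a finite sum). It is of index $d\in\mathbb{Z}_+$ if $\mathcal{H}_d\ne\mathcal{O}$ and $\mathcal{H}_k=\mathcal{O}$ for all $k>d$. For $\eta\in\mathbb{Z}_+$ and an infinite matrix $\mathcal{A}$,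 $\Phi(\mathcal{A},\eta):=\sum_{\ell=0}^{\eta}(-1)^\ell\binom{\eta}{\ell}\,\mathcal{U}^{\eta-\ell}\mathcal{A}\,\mathcal{U}^{-\ell}$. *)

theory Defs
  imports Complex_Main "HOL-Library.Groups_Big_Fun" "HOL-Library.Function_Algebras"
begin

text \<open>
  Infinite matrices are functions of two indices starting at 0. Addition, subtraction,
  finite sums and the null matrix \<open>0\<close> come from the pointwise instances of
  \<^theory>\<open>HOL-Library.Function_Algebras\<close>. The pointwise \<open>*\<close>, \<open>1\<close> and \<open>^\<close> of that theory are
  not the matrix operations and are never used on matrices here.
\<close>

type_synonym inf_mat = "nat \<Rightarrow> nat \<Rightarrow> real"

text \<open>
  \<^const>\<open>Sum_any\<close> adds up the nonzero terms (and is 0 by convention if there are infinitely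
  many of them). In every product below the
  left factor has finitely supported rows or the right factor finitely supported columns,
  so the convention is never invoked.
\<close>

definition mat_mult :: "inf_mat \<Rightarrow> inf_mat \<Rightarrow> inf_mat"  (infixl "\<odot>" 70) where
  "A \<odot> B = (\<lambda>i j. Sum_any (\<lambda>k. A i k * B k j))"

definition mat_scale :: "real \<Rightarrow> inf_mat \<Rightarrow> inf_mat"  (infixr "\<cdot>" 75) where
  "c \<cdot> A = (\<lambda>i j. c * A i j)"

definition mat_transpose :: "inf_mat \<Rightarrow> inf_mat" where
  "mat_transpose A = (\<lambda>i j. A j i)"

definition unit_mat :: inf_mat where
  "unit_mat = (\<lambda>i j. if i = j then 1 else 0)"

primrec mat_pow :: "inf_mat \<Rightarrow> nat \<Rightarrow> inf_mat" where
  "mat_pow A 0 = unit_mat"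
| "mat_pow A (Suc n) = mat_pow A n \<odot> A"

definition upper_shift :: inf_mat where
  "upper_shift = (\<lambda>i j. if i + 1 = j then 1 else 0)"

abbreviation U_pow :: "nat \<Rightarrow> inf_mat" where
  "U_pow m \<equiv> mat_pow upper_shift m"

text \<open>Nonpositive powers: the transpose of the upper shift is only a right inverse of it.\<close>

abbreviation U_neg_pow :: "nat \<Rightarrow> inf_mat" where
  "U_neg_pow m \<equiv> mat_pow (mat_transpose upper_shift) m"

definition symmetric_mat :: "inf_mat \<Rightarrow> bool" where
  "symmetric_mat A \<longleftrightarrow> mat_transpose A = A"

definition hankel :: "inf_mat \<Rightarrow> bool" where
  "hankel H \<longleftrightarrow> (\<forall>i j. H i (j + 1) = H (i + 1) j)"

definition diag_fact :: "nat \<Rightarrow> inf_mat" where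
  "diag_fact k = (\<lambda>i j. if i = j then fact (k + i) / fact i else 0)"

definition hs_term :: "nat \<Rightarrow> inf_mat \<Rightarrow> inf_mat" where
  "hs_term k H = U_neg_pow k \<odot> diag_fact k \<odot> H \<odot> diag_fact k \<odot> U_pow k"

text \<open>
  The infinite series of matrices is taken entrywise; the \<open>(i, j)\<close> entry of its \<open>k\<close>-th term
  vanishes for \<open>k > min i j\<close>.
\<close>

definition hs_decomposition :: "(nat \<Rightarrow> inf_mat) \<Rightarrow> inf_mat \<Rightarrow> bool" where
  "hs_decomposition H M \<longleftrightarrow>
     (\<forall>k. hankel (H k)) \<and> M = (\<lambda>i j. Sum_any (\<lambda>k. hs_term k (H k) i j))"

definition hankel_sobolev_of_index :: "nat \<Rightarrow> inf_mat \<Rightarrow> bool" where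
  "hankel_sobolev_of_index d M \<longleftrightarrow>
     (\<exists>H. hs_decomposition H M \<and> H d \<noteq> 0 \<and> (\<forall>k>d. H k = 0))"

definition Phi :: "inf_mat \<Rightarrow> nat \<Rightarrow> inf_mat" where
  "Phi A \<eta> = (\<Sum>l=0..\<eta>. ((-1) ^ l * real (\<eta> choose l)) \<cdot> (U_pow (\<eta> - l) \<odot> A \<odot> U_neg_pow l))"

end

theory Submission
  imports Defs
begin

text \<open>
  Put \<open>\<Delta>A = \<U>A - A\<U>\<^sup>-\<^sup>1\<close>, so that \<open>\<Phi>(A, n) = \<Delta>\<^sup>n A\<close> and Hankel matrices form the kernel
  of \<open>\<Delta>\<close>. On the matrices with entries \<open>(i)\<^sub>a (j)\<^sub>b h(i + j - a - b)\<close>, where \<open>(i)\<^sub>a\<close> is a falling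
  factorial, \<open>\<Delta>\<close> obeys a Leibniz rule, so that the \<open>k\<close>-th term of a Hankel-Sobolev sum is mapped by
  \<open>\<Delta>\<^sup>2\<^sup>k\<close> to \<open>(-1)\<^sup>k (2k)! H\<^sub>k\<close> and is annihilated by \<open>\<Delta>\<^sup>2\<^sup>k\<^sup>+\<^sup>1\<close>. This reads off the top term. Conversely,
  after subtracting the top term one has \<open>\<Delta>\<^sup>2\<^sup>d M' = 0\<close>; since \<open>\<Delta>\<close> anticommutes with transposition,
  \<open>\<Delta>\<^sup>2\<^sup>d\<^sup>-\<^sup>1 M'\<close> is antisymmetric, but it is also Hankel, hence symmetric, hence zero, and one
  recurses. In a decomposition with possibly infinitely many terms, row \<open>i\<close> of the sum determines
  \<open>H\<^sub>i\<close> from \<open>H\<^sub>0, \<dots>, H\<^sub>i\<^sub>-\<^sub>1\<close>, so the decomposition is unique.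
\<close>

section \<open>Entries of matrix products\<close>

lemma mat_mult_single_row:
  assumes "\<And>k. k \<noteq> c \<Longrightarrow> A i k = 0"
  shows "(A \<odot> B) i j = A i c * B c j"
proof -
  have "{k. A i k * B k j \<noteq> 0} \<subseteq> {c}"
    using assms by auto
  then show ?thesis
    by (simp add: mat_mult_def Sum_any.expand_superset[of "{c}"])
qed

lemma mat_mult_single_col:
  assumes "\<And>k. k \<noteq> c \<Longrightarrow> B k j = 0"
  shows "(A \<odot> B) i j = A i c * B c j"
proof -
  have "{k. A i k * B k j \<noteq> 0} \<subseteq> {c}"
    using assms by auto
  then show ?thesis
    by (simp add: mat_mult_def Sum_any.expand_superset[of "{c}"])
qed

lemma U_pow_entry: "U_pow m i j = (if i + m = j then 1 else 0)"
proof (induction m arbitrary: i j)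
  case (Suc m)
  have "(U_pow m \<odot> upper_shift) i j = U_pow m i (i + m) * upper_shift (i + m) j"
    by (rule mat_mult_single_row) (simp add: Suc.IH)
  then show ?case
    by (simp only: mat_pow.simps Suc.IH) (simp add: upper_shift_def)
qed (simp add: unit_mat_def)

lemma U_neg_pow_entry: "U_neg_pow m i j = (if j + m = i then 1 else 0)"
proof (induction m arbitrary: i j)
  case (Suc m)
  have "(U_neg_pow m \<odot> mat_transpose upper_shift) i j
      = U_neg_pow m i (j + 1) * mat_transpose upper_shift (j + 1) j"
    by (rule mat_mult_single_col) (simp add: mat_transpose_def upper_shift_def)
  then show ?case
    by (simp only: mat_pow.simps Suc.IH) (simp add: mat_transpose_def upper_shift_def)
qed (simp add: unit_mat_def)

lemma U_pow_mult_entry: "(U_pow m \<odot> A) i j = A (i + m) j"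
  using mat_mult_single_row[of "i + m" "U_pow m" i A j] by (simp add: U_pow_entry)

lemma mult_U_neg_pow_entry: "(A \<odot> U_neg_pow m) i j = A i (j + m)"
  using mat_mult_single_col[of "j + m" "U_neg_pow m" j A i] by (simp add: U_neg_pow_entry)

lemma U_neg_pow_mult_entry: "(U_neg_pow m \<odot> A) i j = (if m \<le> i then A (i - m) j else 0)"
  using mat_mult_single_row[of "i - m" "U_neg_pow m" i A j] by (auto simp: U_neg_pow_entry)

lemma mult_U_pow_entry: "(A \<odot> U_pow m) i j = (if m \<le> j then A i (j - m) else 0)"
  using mat_mult_single_col[of "j - m" "U_pow m" j A i] by (auto simp: U_pow_entry)

lemma mult_diag_fact_entry: "(A \<odot> diag_fact k) i j = A i j * (fact (k + j) / fact j)"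
  using mat_mult_single_col[of j "diag_fact k" j A i] by (simp add: diag_fact_def)

section \<open>Falling factorials and the entries of a Hankel-Sobolev term\<close>

definition falling_fact :: "nat \<Rightarrow> nat \<Rightarrow> real" where
  "falling_fact a i = fact a * real (i choose a)"

lemma falling_fact_0 [simp]: "falling_fact 0 i = 1"
  by (simp add: falling_fact_def)

text \<open>Pascal's rule. For \<open>a = 0\<close> the truncated \<open>a - 1\<close> is harmless
  because of the factor \<open>real a\<close>.\<close>

lemma falling_fact_Suc: "falling_fact a (Suc i) = falling_fact a i + real a * falling_fact (a - 1) i"
  by (cases a) (simp_all add: falling_fact_def algebra_simps)

lemma falling_fact_eq_0 [simp]: "i < a \<Longrightarrow> falling_fact a i = 0"
  by (simp add: falling_fact_def)

lemma falling_fact_eq: "a \<le> i \<Longrightarrow> falling_fact a i = fact i / fact (i - a)"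
  by (simp add: falling_fact_def binomial_fact)

lemma falling_fact_nonzero: "a \<le> i \<Longrightarrow> falling_fact a i \<noteq> 0"
  by (simp add: falling_fact_eq)

text \<open>At the shifted index \<open>i - k\<close> the diagonal factor is
  \<open>fact i / fact (i - k)\<close>, a falling factorial. Below index \<open>k\<close> both sides
  vanish, so truncated subtraction does no harm.\<close>

lemma hs_term_entry:
  "hs_term k H i j = falling_fact k i * falling_fact k j * H (i - k) (j - k)"
proof (cases "k \<le> i \<and> k \<le> j")
  case True
  have "(U_neg_pow k \<odot> diag_fact k) i l = 0" if "l \<noteq> i - k" for l
    using that by (auto simp: mult_diag_fact_entry U_neg_pow_entry)
  then have "(U_neg_pow k \<odot> diag_fact k \<odot> H) i l
      = (U_neg_pow k \<odot> diag_fact k) i (i - k) * H (i - k) l" for l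
    by (rule mat_mult_single_row)
  with True show ?thesis
    by (simp add: hs_term_def mult_U_pow_entry mult_diag_fact_entry U_neg_pow_entry falling_fact_eq)
next
  case False
  \<comment> \<open>The left row is zero, so any index, here \<open>0\<close>, can serve as its only
    support.\<close>
  have "(U_neg_pow k \<odot> diag_fact k \<odot> H) i l = 0" if "i < k" for l
    using that mat_mult_single_row[of 0 "U_neg_pow k \<odot> diag_fact k" i H l]
    by (simp add: mult_diag_fact_entry U_neg_pow_entry)
  with False show ?thesis
    by (auto simp: hs_term_def mult_U_pow_entry mult_diag_fact_entry not_le)
qed

lemma hs_term_zero [simp]: "hs_term k 0 = 0"
  by (simp add: fun_eq_iff hs_term_entry)

section \<open>Hankel and symmetric matrices\<close>

lemma hankel_eq_first_row:
  assumes "hankel H"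
  shows "H i j = H 0 (i + j)"
proof (induction i arbitrary: j)
  case (Suc i)
  have "H (Suc i) j = H i (Suc j)"
    using assms by (simp add: hankel_def)
  then show ?case by (simp add: Suc.IH)
qed simp

lemma symmetric_mat_entry: "symmetric_mat A \<longleftrightarrow> (\<forall>i j. A j i = A i j)"
  by (simp add: symmetric_mat_def mat_transpose_def fun_eq_iff)

lemma symmetric_hankel: "hankel H \<Longrightarrow> symmetric_mat H"
  using hankel_eq_first_row[of H] by (metis add.commute symmetric_mat_entry)

lemma symmetric_hs_term: "hankel H \<Longrightarrow> symmetric_mat (hs_term k H)"
  using symmetric_hankel[of H] by (simp add: symmetric_mat_entry hs_term_entry)

lemma symmetric_add: "symmetric_mat A \<Longrightarrow> symmetric_mat B \<Longrightarrow> symmetric_mat (A + B)"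
  by (simp add: symmetric_mat_entry)

lemma symmetric_diff: "symmetric_mat A \<Longrightarrow> symmetric_mat B \<Longrightarrow> symmetric_mat (A - B)"
  by (simp add: symmetric_mat_entry)

section \<open>The difference operator and its iterates\<close>

definition shift_diff :: "inf_mat \<Rightarrow> inf_mat" where
  "shift_diff A = (\<lambda>i j. A (Suc i) j - A i (Suc j))"

lemma shift_diff_eq_0_iff: "shift_diff A = 0 \<longleftrightarrow> hankel A"
  by (auto simp: shift_diff_def hankel_def fun_eq_iff)

text \<open>Pascal's rule splits the sum in two; the first half simplifies because
  \<open>n choose Suc n\<close> is zero.\<close>

lemma binomial_alternating_sum_Suc:
  fixes g :: "nat \<Rightarrow> real"
  shows "(\<Sum>l\<le>Suc n. (-1) ^ l * real (Suc n choose l) * g l)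
    = (\<Sum>l\<le>n. (-1) ^ l * real (n choose l) * (g l - g (Suc l)))"
proof -
  have "(\<Sum>l\<le>Suc n. (-1) ^ l * real (Suc n choose l) * g l)
      = (g 0 + (\<Sum>l\<le>n. (-1) ^ Suc l * real (n choose Suc l) * g (Suc l)))
        - (\<Sum>l\<le>n. (-1) ^ l * real (n choose l) * g (Suc l))"
    by (subst sum.atMost_Suc_shift) (simp add: algebra_simps sum.distrib sum_negf sum_subtractf)
  also have "g 0 + (\<Sum>l\<le>n. (-1) ^ Suc l * real (n choose Suc l) * g (Suc l))
      = (\<Sum>l\<le>Suc n. (-1) ^ l * real (n choose l) * g l)"
    by (subst sum.atMost_Suc_shift) simp
  finally show ?thesis
    by (simp add: sum_subtractf right_diff_distrib)
qed

lemma sum_mat_entry: "(\<Sum>k\<in>S. F k) i j = (\<Sum>k\<in>S. F k i j)" for F :: "'a \<Rightarrow> inf_mat"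
  by (induction S rule: infinite_finite_induct) simp_all

lemma Phi_entry:
  "Phi A n i j = (\<Sum>l\<le>n. (-1) ^ l * real (n choose l) * A (i + n - l) (j + l))"
  by (simp add: Phi_def sum_mat_entry mat_scale_def mult_U_neg_pow_entry U_pow_mult_entry
      atLeast0AtMost)

lemma Phi_0 [simp]: "Phi A 0 = A"
  by (simp add: fun_eq_iff Phi_entry)

text \<open>Consecutive terms pair into entries of \<open>shift_diff A\<close>, so
  \<open>Phi A n\<close> is the \<open>n\<close>-fold difference of \<open>A\<close>.\<close>

lemma Phi_Suc: "Phi A (Suc n) = Phi (shift_diff A) n"
proof (intro ext)
  fix i j
  show "Phi A (Suc n) i j = Phi (shift_diff A) n i j"
    unfolding Phi_entry binomial_alternating_sum_Suc shift_diff_def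
    by (rule sum.cong) (simp_all add: Suc_diff_le)
qed

text \<open>An operator commutes with its iterates: \<open>Phi_Suc\<close> splits off the first
  difference, this the last.\<close>

lemma shift_diff_Phi: "shift_diff (Phi A n) = Phi A (Suc n)"
  by (induction n arbitrary: A) (simp_all add: Phi_Suc)

lemma Phi_add: "Phi (A + B) n = Phi A n + Phi B n"
  by (simp add: fun_eq_iff Phi_entry sum.distrib algebra_simps)

lemma Phi_diff: "Phi (A - B) n = Phi A n - Phi B n"
  by (simp add: fun_eq_iff Phi_entry sum_subtractf algebra_simps)

lemma Phi_scale: "Phi (c \<cdot> A) n = c \<cdot> Phi A n"
  by (simp add: fun_eq_iff Phi_entry mat_scale_def sum_distrib_left mult_ac)

lemma Phi_zero_mono:
  assumes "Phi A m = 0" "m \<le> n"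
  shows "Phi A n = 0"
  using assms(2)
proof (induction n rule: dec_induct)
  case (step n)
  then show ?case
    by (simp add: shift_diff_Phi[symmetric]) (simp add: shift_diff_def fun_eq_iff)
qed (rule assms(1))

lemma Phi_transpose: "Phi (mat_transpose A) n = (-1) ^ n \<cdot> mat_transpose (Phi A n)"
proof (induction n)
  case (Suc n)
  have "Phi (mat_transpose A) (Suc n) = shift_diff ((-1) ^ n \<cdot> mat_transpose (Phi A n))"
    by (simp only: Suc.IH shift_diff_Phi[symmetric])
  also have "\<dots> = (-1) ^ Suc n \<cdot> mat_transpose (shift_diff (Phi A n))"
    by (simp add: fun_eq_iff shift_diff_def mat_scale_def mat_transpose_def algebra_simps)
  finally show ?case
    by (simp only: shift_diff_Phi)
qed (simp add: fun_eq_iff mat_scale_def)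

lemma Phi_odd_vanishes:
  assumes "symmetric_mat A" "odd n" "Phi A (Suc n) = 0"
  shows "Phi A n = 0"
proof -
  \<comment> \<open>The next difference vanishes, so \<open>Phi A n\<close> is Hankel.\<close>
  have "symmetric_mat (Phi A n)"
    using assms(3) by (intro symmetric_hankel) (simp add: shift_diff_eq_0_iff[symmetric] shift_diff_Phi)
  moreover have "Phi A n = (-1) ^ n \<cdot> mat_transpose (Phi A n)"
    using Phi_transpose[of A n] assms(1) by (simp add: symmetric_mat_def)
  ultimately have "Phi A n = (-1) ^ n \<cdot> Phi A n"
    by (simp add: symmetric_mat_def)
  with assms(2) show ?thesis
    by (simp add: fun_eq_iff mat_scale_def)
qed

section \<open>Iterated differences of Hankel-Sobolev terms\<close>

text \<open>The row and column orders are separate parameters because a difference lowers only one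
  of them at a time.\<close>

definition falling_mat :: "(nat \<Rightarrow> real) \<Rightarrow> nat \<Rightarrow> nat \<Rightarrow> inf_mat" where
  "falling_mat h a b = (\<lambda>i j. falling_fact a i * falling_fact b j * h (i + j - (a + b)))"

lemma shift_diff_falling_mat:
  "shift_diff (falling_mat h a b)
    = real a \<cdot> falling_mat h (a - 1) b - real b \<cdot> falling_mat h a (b - 1)"
proof (intro ext)
  fix i j
  have "shift_diff (falling_mat h a b) i j
      = falling_fact (a - 1) i * falling_fact b j * (real a * h (Suc (i + j) - (a + b)))
        - falling_fact a i * falling_fact (b - 1) j * (real b * h (Suc (i + j) - (a + b)))"
    by (simp add: shift_diff_def falling_mat_def falling_fact_Suc algebra_simps)
  also have "real a * h (Suc (i + j) - (a + b)) = real a * h (i + j - (a - 1 + b))"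
    by (cases a) simp_all
  also have "real b * h (Suc (i + j) - (a + b)) = real b * h (i + j - (a + (b - 1)))"
    by (cases b) simp_all
  finally show "shift_diff (falling_mat h a b) i j
    = (real a \<cdot> falling_mat h (a - 1) b - real b \<cdot> falling_mat h a (b - 1)) i j"
    by (simp add: falling_mat_def mat_scale_def mult_ac)
qed

text \<open>Every way of lowering \<open>(a, b)\<close> to \<open>(0, 0)\<close> takes
  \<open>b\<close> negative steps, so no cancellation occurs; at each stage the weights
  \<open>a\<close> and \<open>b\<close> add up to \<open>a + b\<close>.\<close>

lemma Phi_falling_mat:
  "Phi (falling_mat h a b) (a + b) = ((-1) ^ b * fact (a + b)) \<cdot> falling_mat h 0 0"
proof (induction "a + b" arbitrary: a b)
  case 0
  then show ?case by (simp add: mat_scale_def)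
next
  case (Suc n)
  have "Phi (falling_mat h a b) (Suc n)
      = real a \<cdot> Phi (falling_mat h (a - 1) b) n - real b \<cdot> Phi (falling_mat h a (b - 1)) n"
    by (simp only: Phi_Suc shift_diff_falling_mat Phi_diff Phi_scale)
  \<comment> \<open>For \<open>a = 0\<close> the induction hypothesis does not apply, but both sides
    are zero.\<close>
  also have "real a \<cdot> Phi (falling_mat h (a - 1) b) n
      = (real a * (-1) ^ b * fact n) \<cdot> falling_mat h 0 0"
  proof (cases a)
    case (Suc a')
    with Suc.hyps(1)[of a' b] Suc.hyps(2) show ?thesis by (simp add: mat_scale_def fun_eq_iff)
  qed (simp add: mat_scale_def)
  also have "real b \<cdot> Phi (falling_mat h a (b - 1)) n
      = (- real b * (-1) ^ b * fact n) \<cdot> falling_mat h 0 0"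
  proof (cases b)
    case (Suc b')
    with Suc.hyps(1)[of a b'] Suc.hyps(2) show ?thesis
      by (simp add: mat_scale_def fun_eq_iff algebra_simps)
  qed (simp add: mat_scale_def)
  also have "(real a * (-1) ^ b * fact n) \<cdot> falling_mat h 0 0
        - (- real b * (-1) ^ b * fact n) \<cdot> falling_mat h 0 0
      = ((-1) ^ b * (real (a + b) * fact n)) \<cdot> falling_mat h 0 0"
    by (simp add: mat_scale_def fun_eq_iff algebra_simps)
  finally show ?case
    by (simp add: Suc.hyps(2)[symmetric])
qed

lemma Phi_hs_term:
  assumes "hankel H"
  shows "Phi (hs_term k H) (2 * k) = ((-1) ^ k * fact (2 * k)) \<cdot> H"
proof -
  have "hs_term k H = falling_mat (H 0) k k"
  proof (intro ext)
    fix i j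
    show "hs_term k H i j = falling_mat (H 0) k k i j"
    \<comment> \<open>Outside this range the arguments of \<open>H\<close> and \<open>H 0\<close>
      may disagree, but a falling factorial is zero.\<close>
    proof (cases "k \<le> i \<and> k \<le> j")
      case True
      then have "i - k + (j - k) = i + j - (k + k)" by simp
      then show ?thesis
        using hankel_eq_first_row[OF assms, of "i - k" "j - k"]
        by (simp add: hs_term_entry falling_mat_def)
    qed (auto simp: hs_term_entry falling_mat_def not_le)
  qed
  moreover have "falling_mat (H 0) 0 0 = H"
    using hankel_eq_first_row[OF assms] by (simp add: fun_eq_iff falling_mat_def)
  ultimately show ?thesis
    using Phi_falling_mat[of "H 0" k k] by (simp add: mult_2)
qed

lemma Phi_hs_term_eq_0:
  assumes "hankel H" "2 * k < n"
  shows "Phi (hs_term k H) n = 0"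
proof (rule Phi_zero_mono)
  have "shift_diff H = 0"
    using assms(1) by (simp add: shift_diff_eq_0_iff)
  then show "Phi (hs_term k H) (Suc (2 * k)) = 0"
    by (simp only: shift_diff_Phi[symmetric] Phi_hs_term[OF assms(1)])
      (simp add: fun_eq_iff shift_diff_def mat_scale_def)
qed (use assms(2) in simp)

lemma Phi_sum_hs_terms_eq_0:
  assumes "\<And>k. hankel (H k)" "2 * d < n"
  shows "Phi (\<Sum>k\<le>d. hs_term k (H k)) n = 0"
  using assms(2) by (induction d) (simp_all add: Phi_add Phi_hs_term_eq_0 assms(1))

lemma Phi_sum_hs_terms:
  assumes "\<And>k. hankel (H k)"
  shows "Phi (\<Sum>k\<le>d. hs_term k (H k)) (2 * d) = ((-1) ^ d * fact (2 * d)) \<cdot> H d"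
proof (cases d)
  case 0
  then show ?thesis using Phi_hs_term[OF assms, of 0 0] by simp
next
  case (Suc e)
  have "Phi (\<Sum>k\<le>e. hs_term k (H k)) (2 * d) = 0"
    by (rule Phi_sum_hs_terms_eq_0) (use Suc assms in auto)
  moreover have "(\<Sum>k\<le>d. hs_term k (H k)) = (\<Sum>k\<le>e. hs_term k (H k)) + hs_term d (H d)"
    using Suc by simp
  ultimately show ?thesis
    by (simp add: Phi_add Phi_hs_term assms)
qed

lemma symmetric_sum_hs_terms:
  "(\<And>k. hankel (H k)) \<Longrightarrow> symmetric_mat (\<Sum>k\<le>d. hs_term k (H k))"
  by (induction d) (simp_all add: symmetric_add symmetric_hs_term)

section \<open>Finite decompositions and the index criterion\<close>

lemma Sum_any_hs_terms_eq_sum: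
  assumes "\<forall>k>d. H k = 0"
  shows "(\<lambda>i j. Sum_any (\<lambda>k. hs_term k (H k) i j)) = (\<Sum>k\<le>d. hs_term k (H k))"
proof (intro ext)
  fix i j
  have "{k. hs_term k (H k) i j \<noteq> 0} \<subseteq> {..d}"
    by (rule subsetI, rule ccontr) (use assms in auto)
  then show "Sum_any (\<lambda>k. hs_term k (H k) i j) = (\<Sum>k\<le>d. hs_term k (H k)) i j"
    by (simp add: Sum_any.expand_superset[of "{..d}"] sum_mat_entry)
qed

lemma hs_decomposition_finite_iff:
  assumes "\<forall>k>d. H k = 0"
  shows "hs_decomposition H M \<longleftrightarrow> (\<forall>k. hankel (H k)) \<and> M = (\<Sum>k\<le>d. hs_term k (H k))"
  unfolding hs_decomposition_def Sum_any_hs_terms_eq_sum[OF assms] by (rule refl)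

text \<open>Peels off the top term. No coefficient is required to be nonzero, since the remainder
  may have any smaller index or vanish.\<close>

lemma ex_sum_hs_terms:
  assumes "symmetric_mat M" "Phi M (2 * d + 1) = 0"
  shows "\<exists>H. (\<forall>k. hankel (H k)) \<and> (\<forall>k>d. H k = 0) \<and> M = (\<Sum>k\<le>d. hs_term k (H k))"
  using assms
proof (induction d arbitrary: M)
  case 0
  have "Phi M (2 * 0 + 1) = shift_diff M"
    by (simp add: Phi_Suc)
  with 0(2) have "hankel M"
    by (simp only: shift_diff_eq_0_iff)
  moreover have "hs_term 0 M = M"
    by (simp add: fun_eq_iff hs_term_entry)
  moreover have "hankel 0"
    by (simp add: hankel_def)
  ultimately show ?case
    by (intro exI[of _ "\<lambda>k. if k = 0 then M else 0"]) simp
next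
  case (Suc d)
  define e where "e = Suc d"
  \<comment> \<open>Normalised so that \<open>hs_term e G\<close> and \<open>M\<close> have the same
    \<open>2 * e\<close>-fold difference.\<close>
  define G where "G = ((-1) ^ e / fact (2 * e)) \<cdot> Phi M (2 * e)"
  define M' where "M' = M - hs_term e G"
  have "hankel (Phi M (2 * e))"
    using Suc.prems(2) unfolding shift_diff_eq_0_iff[symmetric] shift_diff_Phi e_def
    by (simp only: Suc_eq_plus1)
  then have G: "hankel G"
    by (simp add: hankel_def G_def mat_scale_def)
  have sym: "symmetric_mat M'"
    unfolding M'_def by (intro symmetric_diff symmetric_hs_term G Suc.prems(1))
  have "((-1) ^ e * fact (2 * e)) \<cdot> G = Phi M (2 * e)"
    by (simp add: G_def mat_scale_def fun_eq_iff power_mult_distrib[symmetric])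
  then have "Phi M' (2 * e) = 0"
    by (simp add: M'_def Phi_diff Phi_hs_term G)
  \<comment> \<open>As \<open>2 * e = Suc (2 * d + 1)\<close>, the parity argument supplies the one
    order missing for the induction hypothesis.\<close>
  then have "Phi M' (2 * d + 1) = 0"
    using Phi_odd_vanishes[OF sym, of "2 * d + 1"] unfolding e_def by simp
  from Suc.IH[OF sym this] obtain H where H: "\<forall>k. hankel (H k)" "\<forall>k>d. H k = 0"
    "M' = (\<Sum>k\<le>d. hs_term k (H k))" by blast
  have "(\<Sum>k\<le>d. hs_term k ((H(e := G)) k)) = (\<Sum>k\<le>d. hs_term k (H k))"
    by (rule sum.cong) (simp_all add: e_def)
  then have "M = (\<Sum>k\<le>Suc d. hs_term k ((H(e := G)) k))"
    using H(3) by (simp add: M'_def e_def algebra_simps)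
  with H G show ?case
    by (intro exI[of _ "H(e := G)"]) (simp add: e_def)
qed

lemma hankel_sobolev_of_index_iff:
  "hankel_sobolev_of_index d M \<longleftrightarrow>
    symmetric_mat M \<and> Phi M (2 * d + 1) = 0 \<and> Phi M (2 * d) \<noteq> 0"
proof
  assume "hankel_sobolev_of_index d M"
  then obtain H where H: "\<And>k. hankel (H k)" "H d \<noteq> 0" "M = (\<Sum>k\<le>d. hs_term k (H k))"
    unfolding hankel_sobolev_of_index_def using hs_decomposition_finite_iff by blast
  \<comment> \<open>Only the top term survives, as a nonzero multiple of \<open>H d\<close>.\<close>
  have "Phi M (2 * d) \<noteq> 0"
    using H(2) by (simp add: H(3) Phi_sum_hs_terms H(1)) (simp add: mat_scale_def fun_eq_iff)
  then show "symmetric_mat M \<and> Phi M (2 * d + 1) = 0 \<and> Phi M (2 * d) \<noteq> 0"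
    using H(1) by (simp add: H(3) symmetric_sum_hs_terms Phi_sum_hs_terms_eq_0)
next
  assume M: "symmetric_mat M \<and> Phi M (2 * d + 1) = 0 \<and> Phi M (2 * d) \<noteq> 0"
  then obtain H where H: "\<forall>k. hankel (H k)" "\<forall>k>d. H k = 0" "M = (\<Sum>k\<le>d. hs_term k (H k))"
    using ex_sum_hs_terms by blast
  have "H d \<noteq> 0"
  proof
    assume "H d = 0"
    then have "Phi M (2 * d) = 0"
      using H(1) by (simp add: H(3) Phi_sum_hs_terms) (simp add: mat_scale_def fun_eq_iff)
    with M show False by simp
  qed
  then show "hankel_sobolev_of_index d M"
    unfolding hankel_sobolev_of_index_def using H hs_decomposition_finite_iff by blast
qed

section \<open>Uniqueness and recovery of the Hankel matrices\<close>

lemma hs_decomposition_entry: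
  assumes "hs_decomposition H M"
  shows "M i j = (\<Sum>k\<le>i. hs_term k (H k) i j)"
proof -
  have "{k. hs_term k (H k) i j \<noteq> 0} \<subseteq> {..i}"
    by (rule subsetI, rule ccontr) (auto simp: hs_term_entry)
  with assms show ?thesis
    by (simp add: hs_decomposition_def Sum_any.expand_superset[of "{..i}"])
qed

lemma hs_decomposition_unique:
  assumes "hs_decomposition H M" "hs_decomposition H' M"
  shows "H = H'"
proof
  fix k
  show "H k = H' k"
  proof (induction k rule: less_induct)
    case (less k)
    have "H k 0 n = H' k 0 n" for n
    proof -
      \<comment> \<open>Row \<open>k\<close> is the first that \<open>H k\<close> reaches, and
        column \<open>k + n\<close> picks out \<open>H k 0 n\<close> with a nonzero factor.\<close>
      have "(\<Sum>l\<le>k. hs_term l (H l) k (k + n)) = (\<Sum>l\<le>k. hs_term l (H' l) k (k + n))"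
        using assms by (simp flip: hs_decomposition_entry)
      moreover have "(\<Sum>l<k. hs_term l (H l) k (k + n)) = (\<Sum>l<k. hs_term l (H' l) k (k + n))"
        by (rule sum.cong) (simp_all add: less)
      ultimately have "hs_term k (H k) k (k + n) = hs_term k (H' k) k (k + n)"
        by (simp add: lessThan_Suc_atMost[symmetric])
      then show ?thesis
        by (simp add: hs_term_entry falling_fact_nonzero)
    qed
    moreover have "hankel (H k)" "hankel (H' k)"
      using assms by (simp_all add: hs_decomposition_def)
    ultimately show ?case
      by (metis hankel_eq_first_row)
  qed
qed

text \<open>Each step of the recursion strips the current top term, so
  \<open>Phi_sum_hs_terms\<close> applies to every remainder.\<close>

lemma remainder_eq_sum_hs_terms:
  assumes "Ms d = (\<Sum>k\<le>d. hs_term k (H k))"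
    and "\<forall>k\<in>{1..d}. Ms (d - k) = Ms (d - k + 1) - hs_term (d + 1 - k) (H (d + 1 - k))"
    and "k \<le> d"
  shows "Ms (d - k) = (\<Sum>r\<le>d - k. hs_term r (H r))"
  using assms(3)
proof (induction k)
  case (Suc k)
  then have "d - k = Suc (d - Suc k)" by simp
  moreover from Suc.prems have "Ms (d - Suc k) = Ms (d - k) - hs_term (d - k) (H (d - k))"
    using assms(2)[rule_format, of "Suc k"] by (simp add: Suc_diff_Suc)
  ultimately show ?case
    using Suc by simp
qed (use assms(1) in simp)

theorem theorem1:
  fixes d :: nat and M :: inf_mat
  shows "(hankel_sobolev_of_index d M \<longleftrightarrow>
            symmetric_mat M \<and> Phi M (2 * d + 1) = 0 \<and> Phi M (2 * d) \<noteq> 0) \<and>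
         (hankel_sobolev_of_index d M \<longrightarrow>
            (\<forall>H Ms :: nat \<Rightarrow> inf_mat.
               hs_decomposition H M \<and>
               Ms d = M \<and>
               (\<forall>k\<in>{1..d}. Ms (d - k) = Ms (d - k + 1) - hs_term (d + 1 - k) (H (d + 1 - k))) \<longrightarrow>
               (\<forall>k\<in>{0..d}. H (d - k) =
                  ((-1) ^ (d - k) / fact (2 * d - 2 * k)) \<cdot> Phi (Ms (d - k)) (2 * d - 2 * k))))"
proof (intro conjI impI allI ballI)
  show "hankel_sobolev_of_index d M \<longleftrightarrow>
      symmetric_mat M \<and> Phi M (2 * d + 1) = 0 \<and> Phi M (2 * d) \<noteq> 0"
    by (rule hankel_sobolev_of_index_iff)
next
  fix H Ms :: "nat \<Rightarrow> inf_mat" and k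
  assume index: "hankel_sobolev_of_index d M"
    and decomp: "hs_decomposition H M \<and> Ms d = M \<and>
      (\<forall>k\<in>{1..d}. Ms (d - k) = Ms (d - k + 1) - hs_term (d + 1 - k) (H (d + 1 - k)))"
    and k: "k \<in> {0..d}"
  \<comment> \<open>The given \<open>H\<close> could a priori have infinitely many nonzero terms;
    uniqueness identifies it with the witness of the index.\<close>
  have "\<forall>k>d. H k = 0"
    using index decomp hs_decomposition_unique unfolding hankel_sobolev_of_index_def by blast
  then have "M = (\<Sum>k\<le>d. hs_term k (H k))"
    using decomp hs_decomposition_finite_iff by blast
  then have "Ms (d - k) = (\<Sum>r\<le>d - k. hs_term r (H r))"
    using remainder_eq_sum_hs_terms[of Ms d H k] decomp k by simp
  then have "Phi (Ms (d - k)) (2 * (d - k)) = ((-1) ^ (d - k) * fact (2 * (d - k))) \<cdot> H (d - k)"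
    using decomp by (simp add: Phi_sum_hs_terms hs_decomposition_def)
  then show "H (d - k) =
      ((-1) ^ (d - k) / fact (2 * d - 2 * k)) \<cdot> Phi (Ms (d - k)) (2 * d - 2 * k)"
    by (simp add: mat_scale_def fun_eq_iff diff_mult_distrib2[symmetric]
        power_mult_distrib[symmetric])
qed

end
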